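(* Let $f:Q_1\times Q_2\to\mathbb R$ be convex in $u\in Q_1$ and concave in $v\in Q_2$, and assume that there exist a number $\nu\in[0,1]$ and constants $L_{11,\nu},L_{12,\nu},L_{21,\nu},L_{22,\nu}<+\infty$ such that $$\|\nabla_uf(u+\Delta u,v+\Delta v)-\nabla_uf(u,v)\|_{1,*}\le L_{11,\nu}\|\Delta u\|_1^\nu+L_{12,\nu}\|\Delta v\|_2^\nu,$$ $$\|\nabla_vf(u+\Delta u,v+\Delta v)-\nabla_vf(u,v)\|_{2,*}\le L_{21,\nu}\|\Delta u\|_1^\nu+L_{22,\nu}\|\Delta v\|_2^\nu$$ for all $u,u+\Delta u\in Q_1$ and $v,v+\Delta v\in Q_2$. Put $L_\nu=L_{11,\nu}+L_{12,\nu}+L_{21,\nu}+L_{22,\nu}$ and let $Q=Q_1\times Q_2$ be bounded. Assume that the Generalized Mirror Prox algorithm (described in the context) with accuracy $\varepsilon>0$ is applied to the operator $$g(x)=\begin{pmatrix}\nabla_uf(u,v)\\-\nabla_vf(u,v)\end{pmatrix},\qquad x=(u,v)\in Q,$$ and let $w_i=(u^i,v^i)$ be the sequence it generates. Then, for all $k\ge1$, $$\max_{v\in Q_2}f(\widehat u_k,v)-\min_{u\in Q_1}f(u,\widehat v_k)\le\frac{2L_\nu^{\frac{2}{1+\nu}}}{k\,\varepsilon^{\frac{1-\nu}{1+\nu}}}\max_{x\in Q}V[z_0](x)+\frac{\varepsilon}{2},$$ where $$(\widehat u_k,\widehat v_k)=\frac{1}{S_k}\sum_{i=0}^{k-1}M_i^{-1}(u^i,v^i),\qquad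 S_k=\sum_{i=0}^{k-1}M_i^{-1}.$$ Moreover, in the number of iterations $$O\left(\inf_{\nu\in[0,1]}\left(\frac{L_\nu}{\varepsilon}\right)^{\frac{2}{1+\nu}}\cdot\max_{x\in Q}V[z_0](x)\right)$$ (with an absolute constant in $O(\cdot)$, and $L_\nu=+\infty$ for those $\nu$ for which there are no finite constants $L_{11,\nu},L_{12,\nu},L_{21,\nu},L_{22,\nu}$ such that $\|\nabla_uf(u+\Delta u,v+\Delta v)-\nabla_uf(u,v)\|_{1,*}\le L_{11,\nu}\|\Delta u\|_1^\nu+L_{12,\nu}\|\Delta v\|_2^\nu$ and $\|\nabla_vf(u+\Delta u,v+\Delta v)-\nabla_vf(u,v)\|_{2,*}\le L_{21,\nu}\|\Delta u\|_1^\nu+L_{22,\nu}\|\Delta v\|_2^\nu$ for all $u,u+\Delta u\in Q_1$ and $v,v+\Delta v\in Q_2$) the algorithm finds a pair $(\widehat u,\widehat v)$ such that $\max_{v\in Q_2}f(\widehat u,v)-\min_{u\in Q_1}f(u,\widehat v)\le\varepsilon$.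
   Context: $E_1,E_2$ are finite-dimensional real vector spaces with norms $\|\cdot\|_1,\|\cdot\|_2$ (arbitrary norms) and dual norms $\|\cdot\|_{1,*},\|\cdot\|_{2,*}$ on $E_1^*,E_2^*$; $Q_1\subset E_1$, $Q_2\subset E_2$ are convex and closed. On $E=E_1\times E_2$ the norm is $\|(u,v)\|=\max\{\|u\|_1,\|v\|_2\}$, with dual norm $\|(z,w)\|_*=\|z\|_{1,*}+\|w\|_{2,*}$. $\nabla_uf(u,v)$ denotes a (fixed choice of) subgradient of $f(\cdot,v)$ at $u$, and $\nabla_vf(u,v)$ a (fixed choice of) supergradient of $f(u,\cdot)$ at $v$ (i.e. $-\nabla_vf(u,v)$ is a subgradient of $-f(u,\cdot)$). The saddle point problem is $\min_{u\in Q_1}\max_{v\in Q_2}f(u,v)$. Prox-setup: $d:Q\to\mathbb R$ is continuous, convex, with $\min_Qd=0$; it is continuously differentiable on a set $Q^0\subseteq Q$ containing the relative interior of $Q$, and $1$-strongly convex: $d(y)-d(x)-\langle\nabla d(x),y-x\rangle\ge\frac12\|y-x\|^2$ for $x\in Q^0$, $y\in Q$. Bregman divergence: $V[z](x)=d(x)-d(z)-\langle\nabla d(z),x-z\rangle$, $x\in Q$, $z\in Q^0$. Prox-mapping: for $\bar x\in Q^0$, $s\in E^*$, $M>0$, $\arg\min_{x\in Q}\{\langle s,x\rangle+MV[\bar x](x)\}$ denotes a point $\tilde x\in Q^0$ with $\langle s+M[\nabla d(\tilde x)-\nabla d(\bar x)],y-\tilde x\rangle\ge0$ for all $y\in Q$;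 it is assumed to be computable. Generalized Mirror Prox algorithm (exact operator values and prox-mappings). Input: $\varepsilon>0$ and an initial guess $M_{-1}>0$ for the constant $L(\varepsilon/2)=\varepsilon^{-\frac{1-\nu}{1+\nu}}L_\nu^{\frac{2}{1+\nu}}$ (the algorithm does not use $\nu$ or $L_\nu$). Set $z_0=\arg\min_{x\in Q}d(x)\in Q^0$. For $k=0,1,2,\dots$: for $i_k=0,1,2,\dots$ put $M_k=2^{i_k-1}M_{k-1}$ and compute $$w_k=\arg\min_{x\in Q}\{\langle g(z_k),x\rangle+M_kV[z_k](x)\},\qquad z_{k+1}=\arg\min_{x\in Q}\{\langle g(w_k),x\rangle+M_kV[z_k](x)\},$$ stopping at the first $i_k$ for which $$\langle g(w_k)-g(z_k),w_k-z_{k+1}\rangle\le\frac{M_k}{2}\left(\|w_k-z_k\|^2+\|w_k-z_{k+1}\|^2\right)+\frac{\varepsilon}{2};$$ the corresponding $M_k,w_k,z_{k+1}$ are kept.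
   Formalization: The initial guess is assumed to satisfy M_{-1} ≤ 4L(ε/2), for the given ν in the first claim and for every ν in [0,1] in the second (the claims fail for arbitrarily large guesses); the iteration count is bounded by the maximum of 1 and 8 times the stated quantity. *)

theory Defs
  imports "HOL-Analysis.Analysis"
begin

(* A normed space E_i is a type of class real_normed_vector with a finite spanning set; the class
   norm is then an arbitrary norm on E_i.  All functionals on E_i are bounded, so E_i^* is the type
   of bounded linear functionals, and its norm (the operator norm) is the dual norm. *)

definition finite_dimensional :: "'a::real_normed_vector itself \<Rightarrow> bool" where
  "finite_dimensional _ \<longleftrightarrow> (\<exists>B::'a set. finite B \<and> span B = UNIV)"

type_synonym 'a dual = "'a \<Rightarrow>\<^sub>L real"

(* The library norm on 'a * 'b is the Euclidean combination of the two norms; it induces the same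
   topology as the max norm, which is the one used on E = E_1 * E_2. *)

definition max_norm :: "'a::real_normed_vector \<times> 'b::real_normed_vector \<Rightarrow> real" where
  "max_norm x = max (norm (fst x)) (norm (snd x))"

(* The duality between E_1^* * E_2^* and E_1 * E_2. *)

definition pairing ::
  "('a::real_normed_vector) dual \<times> ('b::real_normed_vector) dual \<Rightarrow> 'a \<times> 'b \<Rightarrow> real" where
  "pairing s x = blinfun_apply (fst s) (fst x) + blinfun_apply (snd s) (snd x)"

definition is_subgradient ::
  "('a::real_normed_vector \<Rightarrow> real) \<Rightarrow> 'a set \<Rightarrow> 'a \<Rightarrow> 'a dual \<Rightarrow> bool" where
  "is_subgradient h S x s \<longleftrightarrow> (\<forall>y\<in>S. h y \<ge> h x + blinfun_apply s (y - x))"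

(* r^\<nu> with the convention 0^0 = 1, whereas 0 powr 0 = 0. *)

definition hpow :: "real \<Rightarrow> real \<Rightarrow> real" where
  "hpow r \<nu> = (if \<nu> = 0 then 1 else r powr \<nu>)"

definition holder_constants ::
  "'a set \<Rightarrow> 'b set \<Rightarrow> ('a::real_normed_vector \<Rightarrow> 'b::real_normed_vector \<Rightarrow> 'a dual) \<Rightarrow>
   ('a \<Rightarrow> 'b \<Rightarrow> 'b dual) \<Rightarrow> real \<Rightarrow> real \<Rightarrow> real \<Rightarrow> real \<Rightarrow> real \<Rightarrow> bool" where
  "holder_constants Q1 Q2 gu gv \<nu> L11 L12 L21 L22 \<longleftrightarrow>
     0 \<le> L11 \<and> 0 \<le> L12 \<and> 0 \<le> L21 \<and> 0 \<le> L22 \<and>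
     (\<forall>u\<in>Q1. \<forall>u'\<in>Q1. \<forall>v\<in>Q2. \<forall>v'\<in>Q2.
        norm (gu u' v' - gu u v) \<le> L11 * hpow (norm (u' - u)) \<nu> + L12 * hpow (norm (v' - v)) \<nu> \<and>
        norm (gv u' v' - gv u v) \<le> L21 * hpow (norm (u' - u)) \<nu> + L22 * hpow (norm (v' - v)) \<nu>)"

(* L \<nu> is the sum of some admissible finite constants for the exponent \<nu>,
   and infinity if there are none. *)

definition holder_family ::
  "'a set \<Rightarrow> 'b set \<Rightarrow> ('a::real_normed_vector \<Rightarrow> 'b::real_normed_vector \<Rightarrow> 'a dual) \<Rightarrow>
   ('a \<Rightarrow> 'b \<Rightarrow> 'b dual) \<Rightarrow> (real \<Rightarrow> ereal) \<Rightarrow> bool" where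
  "holder_family Q1 Q2 gu gv L \<longleftrightarrow>
     (\<forall>\<nu>\<in>{0..1}.
        if \<exists>a b c e. holder_constants Q1 Q2 gu gv \<nu> a b c e
        then \<exists>a b c e. holder_constants Q1 Q2 gu gv \<nu> a b c e \<and> L \<nu> = ereal (a + b + c + e)
        else L \<nu> = \<infinity>)"

(* Real powers of nonnegative extended reals, for exponents p > 0. *)

definition ereal_powr :: "ereal \<Rightarrow> real \<Rightarrow> ereal" where
  "ereal_powr x p = (if x = \<infinity> then \<infinity> else ereal (real_of_ereal x powr p))"

definition saddle_operator ::
  "('a::real_normed_vector \<Rightarrow> 'b::real_normed_vector \<Rightarrow> 'a dual) \<Rightarrow> ('a \<Rightarrow> 'b \<Rightarrow> 'b dual) \<Rightarrow>
   'a \<times> 'b \<Rightarrow> 'a dual \<times> 'b dual" where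
  "saddle_operator gu gv x = (gu (fst x) (snd x), - gv (fst x) (snd x))"

(* d' is the gradient of d on Q0.  As d is only given on Q, it is a derivative within Q; if Q is
   not full-dimensional this determines d' x only on directions parallel to the affine hull of Q,
   and no other values are used. *)

definition prox_setup ::
  "('a::real_normed_vector \<times> 'b::real_normed_vector) set \<Rightarrow> ('a \<times> 'b) set \<Rightarrow>
   ('a \<times> 'b \<Rightarrow> real) \<Rightarrow> ('a \<times> 'b \<Rightarrow> 'a dual \<times> 'b dual) \<Rightarrow> bool" where
  "prox_setup Q Q0 d d' \<longleftrightarrow>
     continuous_on Q d \<and> convex_on Q d \<and>
     (\<forall>x\<in>Q. 0 \<le> d x) \<and> (\<exists>x\<in>Q. d x = 0) \<and>
     Q0 \<subseteq> Q \<and> rel_interior Q \<subseteq> Q0 \<and>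
     (\<forall>x\<in>Q0. (d has_derivative pairing (d' x)) (at x within Q)) \<and> continuous_on Q0 d' \<and>
     (\<forall>x\<in>Q0. \<forall>y\<in>Q. d y - d x - pairing (d' x) (y - x) \<ge> 1 / 2 * (max_norm (y - x))\<^sup>2)"

definition bregman ::
  "('a::real_normed_vector \<times> 'b::real_normed_vector \<Rightarrow> real) \<Rightarrow>
   ('a \<times> 'b \<Rightarrow> 'a dual \<times> 'b dual) \<Rightarrow> 'a \<times> 'b \<Rightarrow> 'a \<times> 'b \<Rightarrow> real" where
  "bregman d d' z x = d x - d z - pairing (d' z) (x - z)"

(* P s y M is the point denoted by argmin {<s,x> + M V[y](x) : x in Q}. *)

definition prox_mapping ::
  "('a::real_normed_vector \<times> 'b::real_normed_vector) set \<Rightarrow> ('a \<times> 'b) set \<Rightarrow>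
   ('a \<times> 'b \<Rightarrow> 'a dual \<times> 'b dual) \<Rightarrow>
   ('a dual \<times> 'b dual \<Rightarrow> 'a \<times> 'b \<Rightarrow> real \<Rightarrow> 'a \<times> 'b) \<Rightarrow> bool" where
  "prox_mapping Q Q0 d' P \<longleftrightarrow>
     (\<forall>s. \<forall>y\<in>Q0. \<forall>M>0. P s y M \<in> Q0 \<and>
        (\<forall>x\<in>Q. pairing (s + M *\<^sub>R (d' (P s y M) - d' y)) (x - P s y M) \<ge> 0))"

(* In the following, P is a prox-mapping, g the operator, eps the accuracy, and M_init the initial
   guess M_(-1).  The points w_k and z_(k+1) computed from z = z_k for a trial value M of M_k: *)

definition trial_w where
  "trial_w P g z M = P (g z) z M"

definition trial_z where
  "trial_z P g z M = P (g (trial_w P g z M)) z M"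

definition accepted ::
  "(('a::real_normed_vector) dual \<times> ('b::real_normed_vector) dual \<Rightarrow> 'a \<times> 'b \<Rightarrow> real \<Rightarrow> 'a \<times> 'b) \<Rightarrow>
   ('a \<times> 'b \<Rightarrow> 'a dual \<times> 'b dual) \<Rightarrow> real \<Rightarrow> 'a \<times> 'b \<Rightarrow> real \<Rightarrow> bool" where
  "accepted P g eps z M \<longleftrightarrow>
     (let w = trial_w P g z M; z' = trial_z P g z M in
      pairing (g w - g z) (w - z')
        \<le> M / 2 * ((max_norm (w - z))\<^sup>2 + (max_norm (w - z'))\<^sup>2) + eps / 2)"

(* LEAST is unspecified if no trial is ever accepted, so results about the iterates below
   include the termination of the line search. *)

definition line_search where
  "line_search P g eps z M_prev =
     2 powi (int (LEAST i. accepted P g eps z (2 powi (int i - 1) * M_prev)) - 1) * M_prev"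

(* The pair (z_k, M_(k-1)). *)

primrec gmp_state where
  "gmp_state P g eps M_init z0 0 = (z0, M_init)"
| "gmp_state P g eps M_init z0 (Suc k) =
     (let (z, M_prev) = gmp_state P g eps M_init z0 k;
          M = line_search P g eps z M_prev
      in (trial_z P g z M, M))"

definition gmp_z where
  "gmp_z P g eps M_init z0 k = fst (gmp_state P g eps M_init z0 k)"

definition gmp_M where
  "gmp_M P g eps M_init z0 k = snd (gmp_state P g eps M_init z0 (Suc k))"

definition gmp_w where
  "gmp_w P g eps M_init z0 k =
     trial_w P g (gmp_z P g eps M_init z0 k) (gmp_M P g eps M_init z0 k)"

definition gmp_average ::
  "(('a::real_normed_vector) dual \<times> ('b::real_normed_vector) dual \<Rightarrow> 'a \<times> 'b \<Rightarrow> real \<Rightarrow> 'a \<times> 'b) \<Rightarrow>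
   ('a \<times> 'b \<Rightarrow> 'a dual \<times> 'b dual) \<Rightarrow> real \<Rightarrow> real \<Rightarrow> 'a \<times> 'b \<Rightarrow> nat \<Rightarrow> 'a \<times> 'b" where
  "gmp_average P g eps M_init z0 k =
     (1 / (\<Sum>i<k. 1 / gmp_M P g eps M_init z0 i)) *\<^sub>R
     (\<Sum>i<k. (1 / gmp_M P g eps M_init z0 i) *\<^sub>R gmp_w P g eps M_init z0 i)"

(* max over v in Q2 of f(u,v) minus min over u in Q1 of f(u,v), evaluated at x = (u,v); extended
   reals avoid the unspecified supremum of an unbounded set of reals. *)

definition duality_gap ::
  "'a set \<Rightarrow> 'b set \<Rightarrow> ('a \<Rightarrow> 'b \<Rightarrow> real) \<Rightarrow> 'a \<times> 'b \<Rightarrow> ereal" where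
  "duality_gap Q1 Q2 f x = (SUP v\<in>Q2. ereal (f (fst x) v)) - (INF u\<in>Q1. ereal (f u (snd x)))"

end

(* The optimality conditions of the two prox steps and the acceptance test give
   <g(w_k), w_k - x> <= M_k (V[z_k](x) - V[z_(k+1)](x)) + eps/2.  Dividing by M_k and telescoping
   bounds the gap of the weighted average by V[z_0](x) / S_k + eps/2.  By Young's inequality every
   trial value M >= eps^(-(1-nu)/(1+nu)) L_nu^(2/(1+nu)) = L(eps/2) is accepted, so the doubling
   search keeps M_k <= 2 L(eps/2), and S_k >= k / (2 L(eps/2)).  As the M_k do not depend on nu, this
   holds for all nu at once, and k about 4 inf_nu (L_nu/eps)^(2/(1+nu)) max V[z_0] iterations
   suffice. *)

theory Submission
  imports Defs
begin

section \<open>Compactness in finite-dimensional normed spaces\<close>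

text \<open>Heine-Borel for an arbitrary norm, by induction on the spanning set. For a new
  \<open>b\<close>, its positive distance to the closed subspace \<open>span B\<close> bounds the
  coefficient of \<open>b\<close>, so the ball lies in a continuous image of a compact
  product.\<close>

lemma compact_finite_span_cball:
  fixes B :: "'a::real_normed_vector set"
  assumes "finite B"
  shows "compact (span B \<inter> cball 0 R)"
  using assms
proof (induction B arbitrary: R)
  case empty
  then show ?case
    by (simp add: finite_imp_compact)
next
  case (insert b B)
  show ?case
  proof (cases "b \<in> span B")
    case True
    then show ?thesis
      using insert.IH by (simp add: span_redundant)
  next
    case False
    \<comment> \<open>A convergent sequence is bounded, so the induction hypothesis at its bound
      \<open>K\<close> puts the limit into the span.\<close>
    have closed: "closed (span B)"
      unfolding closed_sequential_limits
    proof (intro allI impI, elim conjE)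
      fix x l assume x: "\<forall>n. x n \<in> span B" and lim: "x \<longlonglongrightarrow> l"
      then obtain K where K: "\<And>n. norm (x n) \<le> K"
        using convergent_imp_Bseq[OF convergentI] Bseq_def by blast
      have "closed (span B \<inter> cball 0 K)"
        using insert.IH compact_imp_closed by blast
      then have "l \<in> span B \<inter> cball 0 K"
        by (rule closed_sequentially[OF _ _ lim]) (simp add: x K)
      then show "l \<in> span B"
        by simp
    qed
    define \<delta> where "\<delta> = infdist b (span B)"
    have "\<delta> > 0"
      unfolding \<delta>_def using closed False span_zero[of B]
      by (metis empty_iff infdist_pos_not_in_closed)
    have \<delta>: "\<bar>c\<bar> * \<delta> \<le> norm (x + c *\<^sub>R b)" if "x \<in> span B" for x c
    proof (cases "c = 0")
      case False
      have "\<delta> \<le> dist b (- (1 / c) *\<^sub>R x)"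
        unfolding \<delta>_def using that span_scale by (blast intro: infdist_le)
      also have "\<dots> = norm ((1 / c) *\<^sub>R (x + c *\<^sub>R b))"
        using False by (simp add: dist_norm scaleR_add_right add.commute)
      also have "\<dots> = norm (x + c *\<^sub>R b) / \<bar>c\<bar>"
        by simp
      finally show ?thesis
        using False by (simp add: field_simps)
    qed simp
    define K where "K = R / \<delta>"
    \<comment> \<open>If \<open>norm y\<close> is at most \<open>R\<close>, then \<open>K\<close>
      bounds the coefficient \<open>c\<close> and \<open>R + K * norm b\<close> bounds the remainder
      \<open>y - c *\<^sub>R b\<close>.\<close>
    let ?T = "(\<lambda>(x, c). x + c *\<^sub>R b) ` ((span B \<inter> cball 0 (R + K * norm b)) \<times> {- K..K})"
    have "compact ?T"
      using insert.IH by (intro compact_continuous_image compact_Times)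
        (auto intro!: continuous_intros simp: case_prod_beta)
    moreover have "span (insert b B) \<inter> cball 0 R = ?T \<inter> cball 0 R"
    proof (intro equalityI subsetI)
      fix y assume y: "y \<in> span (insert b B) \<inter> cball 0 R"
      then obtain c where c: "y - c *\<^sub>R b \<in> span B"
        by (auto simp: span_breakdown_eq)
      have "\<bar>c\<bar> * \<delta> \<le> R"
        using \<delta>[OF c, of c] y by simp
      then have "\<bar>c\<bar> \<le> K"
        using \<open>\<delta> > 0\<close> by (simp add: K_def field_simps)
      moreover have "norm (y - c *\<^sub>R b) \<le> R + K * norm b"
        using norm_triangle_ineq4[of y "c *\<^sub>R b"] y
          mult_right_mono[OF \<open>\<bar>c\<bar> \<le> K\<close>, of "norm b"] by simp
      ultimately have "(y - c *\<^sub>R b, c) \<in> (span B \<inter> cball 0 (R + K * norm b)) \<times> {- K..K}"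
        using c by auto
      then show "y \<in> ?T \<inter> cball 0 R"
        using y by (force intro: rev_image_eqI)
    next
      fix y assume "y \<in> ?T \<inter> cball 0 R"
      then show "y \<in> span (insert b B) \<inter> cball 0 R"
        by (auto intro!: span_add span_scale intro: span_base span_mono[THEN subsetD, OF subset_insertI])
    qed
    ultimately show ?thesis
      by (simp add: compact_Int_closed)
  qed
qed

lemma finite_dimensional_compact:
  fixes S :: "'a::real_normed_vector set"
  assumes "finite_dimensional TYPE('a)" and "closed S" and "bounded S"
  shows "compact S"
proof -
  obtain B :: "'a set" where B: "finite B" "span B = UNIV"
    using assms(1) by (auto simp: finite_dimensional_def)
  obtain R where "S \<subseteq> cball 0 R"
    using assms(3) by (auto simp: bounded_iff subset_iff)
  moreover have "compact (cball (0::'a) R)"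
    using compact_finite_span_cball[OF B(1), of R] B(2) by simp
  ultimately show ?thesis
    using assms(2) compact_Int_closed[of "cball 0 R" S] by (simp add: Int_absorb1)
qed

section \<open>The pairing and the max norm\<close>

lemma max_norm_nonneg [simp]: "0 \<le> max_norm x"
  by (simp add: max_norm_def le_max_iff_disj)

lemma norm_fst_le_max_norm: "norm (fst x) \<le> max_norm x"
  and norm_snd_le_max_norm: "norm (snd x) \<le> max_norm x"
  by (simp_all add: max_norm_def)

lemma max_norm_minus_commute: "max_norm (x - y) = max_norm (y - x)"
  by (simp add: max_norm_def norm_minus_commute)

lemma pairing_diff_left: "pairing (s - t) x = pairing s x - pairing t x"
  by (simp add: pairing_def blinfun.diff_left)

lemma pairing_add_left: "pairing (s + t) x = pairing s x + pairing t x"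
  by (simp add: pairing_def blinfun.add_left)

lemma pairing_scaleR_left: "pairing (c *\<^sub>R s) x = c * pairing s x"
  by (simp add: pairing_def blinfun.scaleR_left algebra_simps)

lemma pairing_diff_right: "pairing s (x - y) = pairing s x - pairing s y"
  by (simp add: pairing_def blinfun.diff_right)

text \<open>Each functional is bounded by its own norm and each component by
  \<open>max_norm\<close>; hence the sum of the two dual norms.\<close>

lemma pairing_le: "pairing s x \<le> (norm (fst s) + norm (snd s)) * max_norm x"
proof -
  have *: "blinfun_apply h y \<le> norm h * m" if "norm y \<le> m"
    for h :: "'c::real_normed_vector \<Rightarrow>\<^sub>L real" and y m
    using norm_blinfun[of h y] mult_left_mono[OF that, of "norm h"] by simp
  show ?thesis
    using *[OF norm_fst_le_max_norm[of x], of "fst s"] *[OF norm_snd_le_max_norm[of x], of "snd s"]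
    by (simp add: pairing_def distrib_right)
qed

section \<open>Hoelder continuity as inexact Lipschitz continuity\<close>

text \<open>This is L(\<epsilon>/2), the threshold that the line search approximates without knowing
  \<nu> or L.\<close>

definition smooth_const :: "real \<Rightarrow> real \<Rightarrow> real \<Rightarrow> real" where
  "smooth_const \<epsilon> \<nu> L = \<epsilon> powr (- ((1 - \<nu>) / (1 + \<nu>))) * L powr (2 / (1 + \<nu>))"

text \<open>This form, divided by \<epsilon>, is the factor appearing in the iteration
  count.\<close>

lemma smooth_const_eq:
  assumes "0 < \<epsilon>" "0 \<le> \<nu>" "0 \<le> L"
  shows "smooth_const \<epsilon> \<nu> L = \<epsilon> * (L / \<epsilon>) powr (2 / (1 + \<nu>))"
proof -
  have "- ((1 - \<nu>) / (1 + \<nu>)) = 1 - 2 / (1 + \<nu>)"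
    using assms by (simp add: field_simps)
  then show ?thesis
    using assms by (simp add: smooth_const_def powr_divide powr_diff)
qed

lemma hpow_mono: "0 \<le> \<nu> \<Longrightarrow> 0 \<le> r \<Longrightarrow> r \<le> s \<Longrightarrow> hpow r \<nu> \<le> hpow s \<nu>"
  by (simp add: hpow_def powr_mono2)

text \<open>Young's inequality with the three weights \<open>\<nu>/2\<close>, \<open>1/2\<close>, \<open>(1-\<nu>)/2\<close>, obtained by
  applying the two-term inequality twice.\<close>

lemma hoelder_le_quadratic:
  assumes "\<nu> \<in> {0..1}" "0 < \<epsilon>" "0 \<le> L" "0 \<le> t" "0 \<le> s" "0 < M" "smooth_const \<epsilon> \<nu> L \<le> M"
  shows "L * hpow t \<nu> * s \<le> M / 2 * (t\<^sup>2 + s\<^sup>2) + \<epsilon> / 2"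
proof -
  have \<nu>: "0 \<le> \<nu>" "\<nu> \<le> 1"
    using assms by auto
  \<comment> \<open>Raising the threshold condition to the power \<open>1 + \<nu>\<close> clears the
    fractional exponents.\<close>
  have L: "L\<^sup>2 \<le> M powr (1 + \<nu>) * \<epsilon> powr (1 - \<nu>)"
  proof -
    have "smooth_const \<epsilon> \<nu> L powr (1 + \<nu>) \<le> M powr (1 + \<nu>)"
      using assms \<nu> by (intro powr_mono2) (auto simp: smooth_const_def)
    moreover have "smooth_const \<epsilon> \<nu> L powr (1 + \<nu>) = \<epsilon> powr (- (1 - \<nu>)) * L\<^sup>2"
    proof -
      have "- ((1 - \<nu>) / (1 + \<nu>)) * (1 + \<nu>) = - (1 - \<nu>)" "2 / (1 + \<nu>) * (1 + \<nu>) = 2"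
        using \<nu> by (simp_all add: field_simps)
      then show ?thesis
        using \<open>0 \<le> L\<close> unfolding smooth_const_def by (simp only: powr_mult powr_powr) simp
    qed
    ultimately have "\<epsilon> powr (- (1 - \<nu>)) * L\<^sup>2 * \<epsilon> powr (1 - \<nu>) \<le> M powr (1 + \<nu>) * \<epsilon> powr (1 - \<nu>)"
      by (simp add: mult_right_mono)
    moreover have "\<epsilon> powr (- (1 - \<nu>)) * \<epsilon> powr (1 - \<nu>) = 1"
      using \<open>0 < \<epsilon>\<close> by (simp flip: powr_add)
    ultimately show ?thesis
      by (simp add: mult.assoc mult.left_commute)
  qed
  have "(L * hpow t \<nu>)\<^sup>2 \<le> M * (M * t\<^sup>2 + \<epsilon>)"
  proof (cases "t = 0")
    \<comment> \<open>The convention \<open>hpow 0 0 = 1\<close> matters: for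
      \<open>\<nu> = 0\<close> the claim reduces to the fact \<open>L\<close>, for
      \<open>\<nu> > 0\<close> the left side vanishes.\<close>
    case True
    then show ?thesis
      using L assms by (cases "\<nu> = 0") (auto simp: hpow_def)
  next
    case False
    then have "0 < t"
      using assms by simp
    then have h: "hpow t \<nu> = t powr \<nu>"
      by (simp add: hpow_def)
    have t2: "(t powr \<nu>)\<^sup>2 = (t\<^sup>2) powr \<nu>"
      using \<open>0 < t\<close> by (simp add: power2_eq_square powr_mult)
    have "(L * hpow t \<nu>)\<^sup>2 \<le> M powr (1 + \<nu>) * \<epsilon> powr (1 - \<nu>) * (t\<^sup>2) powr \<nu>"
      using L by (simp add: h power_mult_distrib t2 mult_right_mono)
    also have "\<dots> = M * ((M * t\<^sup>2) powr \<nu> * \<epsilon> powr (1 - \<nu>))"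
      using \<open>0 < M\<close> by (simp add: powr_add powr_mult)
    \<comment> \<open>Young's inequality with weights \<nu> and 1 - \<nu>; the next step drops these
      weights, which are at most 1.\<close>
    also have "\<dots> \<le> M * (\<nu> * (M * t\<^sup>2) + (1 - \<nu>) * \<epsilon>)"
      using \<open>0 < t\<close> \<open>0 < M\<close> \<open>0 < \<epsilon>\<close> \<nu> by (intro mult_left_mono Youngs_inequality_0) auto
    also have "\<dots> \<le> M * (M * t\<^sup>2 + \<epsilon>)"
      using \<open>0 < M\<close> \<open>0 < \<epsilon>\<close> \<nu> by (intro mult_left_mono add_mono mult_left_le_one_le) auto
    finally show ?thesis .
  qed
  then have "(L * hpow t \<nu> * s)\<^sup>2 \<le> M * (M * t\<^sup>2 + \<epsilon>) * s\<^sup>2"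
    by (simp add: power_mult_distrib[of _ s] mult_right_mono)
  also have "\<dots> = (M * s\<^sup>2) * (M * t\<^sup>2 + \<epsilon>)"
    by simp
  \<comment> \<open>Arithmetic-geometric mean inequality, from the square of the difference of the
    two factors.\<close>
  also have "\<dots> \<le> ((M * s\<^sup>2 + (M * t\<^sup>2 + \<epsilon>)) / 2)\<^sup>2"
    using sum_squares_ge_zero[of "M * s\<^sup>2 - (M * t\<^sup>2 + \<epsilon>)" 0]
    by (simp add: power2_eq_square field_simps)
  finally have "L * hpow t \<nu> * s \<le> (M * s\<^sup>2 + (M * t\<^sup>2 + \<epsilon>)) / 2"
    by (rule power2_le_imp_le) (use assms in simp)
  then show ?thesis
    by (simp add: field_simps)
qed

text \<open>Both increments are at most the max norm of \<open>y - x\<close>, and the dual norm adds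
  the two components, so the four constants add up.\<close>

lemma saddle_operator_hoelder:
  assumes "holder_constants Q1 Q2 gu gv \<nu> L11 L12 L21 L22" "0 \<le> \<nu>"
    and "x \<in> Q1 \<times> Q2" "y \<in> Q1 \<times> Q2"
  shows "pairing (saddle_operator gu gv y - saddle_operator gu gv x) h
    \<le> (L11 + L12 + L21 + L22) * hpow (max_norm (y - x)) \<nu> * max_norm h"
proof -
  define r where "r = hpow (max_norm (y - x)) \<nu>"
  have r: "hpow (norm (fst y - fst x)) \<nu> \<le> r" "hpow (norm (snd y - snd x)) \<nu> \<le> r"
    unfolding r_def using assms(2) by (auto intro!: hpow_mono simp: max_norm_def)
  have L: "0 \<le> L11" "0 \<le> L12" "0 \<le> L21" "0 \<le> L22"
    and u: "norm (gu (fst y) (snd y) - gu (fst x) (snd x))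
      \<le> L11 * hpow (norm (fst y - fst x)) \<nu> + L12 * hpow (norm (snd y - snd x)) \<nu>"
    and v: "norm (gv (fst y) (snd y) - gv (fst x) (snd x))
      \<le> L21 * hpow (norm (fst y - fst x)) \<nu> + L22 * hpow (norm (snd y - snd x)) \<nu>"
    using assms by (auto simp: holder_constants_def)
  let ?s = "saddle_operator gu gv y - saddle_operator gu gv x"
  have "norm (fst ?s) \<le> L11 * r + L12 * r"
    using u mult_left_mono[OF r(1) L(1)] mult_left_mono[OF r(2) L(2)]
    by (simp add: saddle_operator_def)
  moreover have "norm (snd ?s) \<le> L21 * r + L22 * r"
    using v mult_left_mono[OF r(1) L(3)] mult_left_mono[OF r(2) L(4)]
    by (simp add: saddle_operator_def norm_minus_commute)
  ultimately have "norm (fst ?s) + norm (snd ?s) \<le> (L11 + L12 + L21 + L22) * r"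
    by (simp add: algebra_simps)
  then have "(norm (fst ?s) + norm (snd ?s)) * max_norm h
      \<le> (L11 + L12 + L21 + L22) * r * max_norm h"
    by (simp add: mult_right_mono)
  then show ?thesis
    using pairing_le[of ?s h] by (simp add: r_def)
qed

section \<open>The mirror prox iteration\<close>

text \<open>Hoelder continuity enters the iteration only through
  \<open>line_search_terminates\<close>: one threshold \<open>K\<close> that serves all points of
  \<open>Q0\<close>.\<close>

locale mirror_prox =
  fixes Q Q0 :: "('a::real_normed_vector \<times> 'b::real_normed_vector) set"
    and d :: "'a \<times> 'b \<Rightarrow> real" and d' g :: "'a \<times> 'b \<Rightarrow> 'a dual \<times> 'b dual"
    and P :: "'a dual \<times> 'b dual \<Rightarrow> 'a \<times> 'b \<Rightarrow> real \<Rightarrow> 'a \<times> 'b"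
    and \<epsilon> M_init :: real and z0 :: "'a \<times> 'b"
  assumes prox: "prox_setup Q Q0 d d'" "prox_mapping Q Q0 d' P"
    and z0: "z0 \<in> Q0" and M_init: "0 < M_init"
    and line_search_terminates:
      "\<exists>K. \<forall>z\<in>Q0. \<forall>M>0. K \<le> M \<longrightarrow> accepted P g \<epsilon> z M"
begin

abbreviation "V \<equiv> bregman d d'"
abbreviation "zs \<equiv> gmp_z P g \<epsilon> M_init z0"
abbreviation "ws \<equiv> gmp_w P g \<epsilon> M_init z0"
abbreviation "Ms \<equiv> gmp_M P g \<epsilon> M_init z0"
abbreviation "M_prev k \<equiv> snd (gmp_state P g \<epsilon> M_init z0 k)"

lemma Q0_subset: "x \<in> Q0 \<Longrightarrow> x \<in> Q"
  using prox(1) by (auto simp: prox_setup_def)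

lemma prox_in_Q0: "z \<in> Q0 \<Longrightarrow> 0 < M \<Longrightarrow> P s z M \<in> Q0"
  using prox(2) unfolding prox_mapping_def by blast

lemma trial_in_Q0:
  assumes "z \<in> Q0" "0 < M"
  shows "trial_w P g z M \<in> Q0" "trial_z P g z M \<in> Q0"
  using assms by (simp_all add: trial_w_def trial_z_def prox_in_Q0)

text \<open>The optimality condition of the prox step, with its gradient difference rewritten by the
  three-point identity for Bregman divergences.\<close>

lemma prox_inequality:
  assumes "z \<in> Q0" "0 < M" "x \<in> Q"
  shows "pairing s (P s z M - x) \<le> M * (V z x - V (P s z M) x - V z (P s z M))"
proof -
  have "0 \<le> pairing (s + M *\<^sub>R (d' (P s z M) - d' z)) (x - P s z M)"
    using prox(2) assms unfolding prox_mapping_def by blast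
  then show ?thesis
    by (simp add: bregman_def pairing_add_left pairing_diff_left pairing_scaleR_left
        pairing_diff_right algebra_simps)
qed

lemma bregman_ge:
  assumes "z \<in> Q0" "x \<in> Q"
  shows "(max_norm (x - z))\<^sup>2 / 2 \<le> V z x"
  using prox(1) assms by (auto simp: prox_setup_def bregman_def)

lemma bregman_nonneg: "z \<in> Q0 \<Longrightarrow> x \<in> Q \<Longrightarrow> 0 \<le> V z x"
  by (rule order_trans[OF _ bregman_ge]) simp_all

text \<open>Split \<open>pairing (g w) (w - x)\<close> into the values of \<open>g w\<close> at
  \<open>z' - x\<close>, of \<open>g z\<close> at \<open>w - z'\<close>, and of
  \<open>g w - g z\<close> at \<open>w - z'\<close>. The prox inequalities bound the first two and
  their terms \<open>V z z'\<close> cancel; strong convexity lets the remaining negative divergences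
  absorb the squares from the acceptance test.\<close>

lemma accepted_step:
  assumes z: "z \<in> Q0" and M: "0 < M" and acc: "accepted P g \<epsilon> z M" and x: "x \<in> Q"
  defines "w \<equiv> trial_w P g z M" and "z' \<equiv> trial_z P g z M"
  shows "pairing (g w) (w - x) \<le> M * (V z x - V z' x) + \<epsilon> / 2"
proof -
  have in_Q0: "w \<in> Q0" "z' \<in> Q0"
    using trial_in_Q0[OF z M] by (simp_all add: w_def z'_def)
  have "pairing (g w) (z' - x) \<le> M * (V z x - V z' x - V z z')"
    using prox_inequality[OF z M x, of "g w"] by (simp add: w_def z'_def trial_z_def)
  moreover have "pairing (g z) (w - z') \<le> M * (V z z' - V w z' - V z w)"
    using prox_inequality[OF z M Q0_subset[OF in_Q0(2)], of "g z"] by (simp add: w_def trial_w_def)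
  moreover have "pairing (g w - g z) (w - z')
      \<le> M / 2 * ((max_norm (w - z))\<^sup>2 + (max_norm (w - z'))\<^sup>2) + \<epsilon> / 2"
    using acc by (simp add: accepted_def Let_def w_def z'_def)
  moreover have "M * ((max_norm (w - z))\<^sup>2 / 2 + (max_norm (w - z'))\<^sup>2 / 2) \<le> M * (V z w + V w z')"
    using bregman_ge[OF z Q0_subset[OF in_Q0(1)]] bregman_ge[OF in_Q0(1) Q0_subset[OF in_Q0(2)]] M
    by (intro mult_left_mono add_mono) (simp_all add: max_norm_minus_commute)
  ultimately show ?thesis
    by (simp add: pairing_diff_left pairing_diff_right algebra_simps)
qed

text \<open>Trial values double, so they pass the acceptance threshold and \<open>LEAST\<close> is
  attained. The last claim records minimality: either the first trial \<open>M0 / 2\<close>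
  succeeded or the trial before \<open>M\<close> failed.\<close>

lemma line_search:
  assumes "z \<in> Q0" "0 < M0"
  defines "M \<equiv> line_search P g \<epsilon> z M0"
  shows "0 < M" and "accepted P g \<epsilon> z M"
    and "M = M0 / 2 \<or> \<not> accepted P g \<epsilon> z (M / 2)"
proof -
  define trial where "trial i = 2 powi (int i - 1) * M0" for i :: nat
  define n where "n = (LEAST i. accepted P g \<epsilon> z (trial i))"
  have M: "M = trial n"
    by (simp add: M_def line_search_def n_def trial_def)
  have pos: "0 < trial i" for i
    using assms by (simp add: trial_def)
  show "0 < M"
    using pos by (simp add: M)
  have trial_Suc: "trial (Suc i) = 2 ^ i * M0" for i
    by (simp add: trial_def)
  obtain K where K: "\<And>M. 0 < M \<Longrightarrow> K \<le> M \<Longrightarrow> accepted P g \<epsilon> z M"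
    using line_search_terminates assms by blast
  obtain i where "K / M0 < 2 ^ i"
    using real_arch_pow[of 2 "K / M0"] by auto
  then have "accepted P g \<epsilon> z (trial (Suc i))"
    using assms pos[of "Suc i"] by (intro K) (auto simp: trial_Suc field_simps)
  then have "accepted P g \<epsilon> z (trial n)"
    unfolding n_def by (rule LeastI)
  then show "accepted P g \<epsilon> z M"
    by (simp add: M)
  show "M = M0 / 2 \<or> \<not> accepted P g \<epsilon> z (M / 2)"
  proof (cases n)
    case 0
    then show ?thesis
      by (simp add: M trial_def power_int_minus)
  next
    case (Suc m)
    \<comment> \<open>The case \<open>m = 0\<close> is separate because \<open>trial 0\<close> has
      the negative exponent -1.\<close>
    have "trial n / 2 = trial m"
      unfolding Suc by (cases m) (simp_all add: trial_Suc, simp add: trial_def power_int_minus)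
    moreover have "\<not> accepted P g \<epsilon> z (trial m)"
      using not_less_Least[of m "\<lambda>i. accepted P g \<epsilon> z (trial i)"] Suc by (simp add: n_def)
    ultimately show ?thesis
      by (simp add: M)
  qed
qed

lemma gmp_M_eq: "Ms k = line_search P g \<epsilon> (zs k) (M_prev k)"
  and gmp_z_Suc: "zs (Suc k) = trial_z P g (zs k) (Ms k)"
  by (simp_all add: gmp_M_def gmp_z_def Let_def case_prod_beta)

text \<open>The two properties are proved together, since the line search needs both to produce a
  positive \<open>Ms k\<close> and the next iterate in \<open>Q0\<close>.\<close>

lemma gmp_state_valid: "zs k \<in> Q0 \<and> 0 < M_prev k"
proof (induction k)
  case 0
  then show ?case
    using z0 M_init by (simp add: gmp_z_def)
next
  case (Suc k)
  then have "0 < Ms k"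
    unfolding gmp_M_eq by (intro line_search) auto
  with Suc show ?case
    by (simp add: gmp_z_Suc trial_in_Q0 gmp_M_def del: gmp_state.simps)
qed

lemma gmp_z_in_Q0: "zs k \<in> Q0"
  and M_prev_pos: "0 < M_prev k"
  using gmp_state_valid by auto

lemma gmp_M_pos: "0 < Ms k"
  using M_prev_pos[of "Suc k"] by (simp only: gmp_M_def)

lemma gmp_w_in_Q: "ws k \<in> Q"
  unfolding gmp_w_def by (intro Q0_subset trial_in_Q0 gmp_z_in_Q0 gmp_M_pos)

text \<open>If \<open>Ms k\<close> exceeded \<open>2 * K\<close>, then \<open>Ms k / 2\<close> would
  be acceptable, and \<open>Ms k\<close> could not be the first trial, which is at most
  \<open>2 * K\<close>; this contradicts minimality. The invariant is that the previous value is at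
  most \<open>4 * K\<close>.\<close>

lemma gmp_M_le:
  assumes "\<And>z M. z \<in> Q0 \<Longrightarrow> 0 < M \<Longrightarrow> K \<le> M \<Longrightarrow> accepted P g \<epsilon> z M"
    and "M_init \<le> 4 * K"
  shows "Ms k \<le> 2 * K"
proof -
  have step: "Ms k \<le> 2 * K" if "M_prev k \<le> 4 * K" for k
  proof (rule ccontr)
    assume "\<not> Ms k \<le> 2 * K"
    then have "accepted P g \<epsilon> (zs k) (Ms k / 2)" "Ms k \<noteq> M_prev k / 2"
      using assms(1)[OF gmp_z_in_Q0, of "Ms k / 2"] gmp_M_pos[of k] that by auto
    then show False
      using line_search(3)[OF gmp_z_in_Q0[of k] M_prev_pos[of k]] by (simp add: gmp_M_eq)
  qed
  have "0 < K"
    using assms(2) M_init by simp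
  have "M_prev k \<le> 4 * K"
  proof (induction k)
    case 0
    then show ?case
      using assms(2) by simp
  next
    case (Suc k)
    then show ?case
      using step[of k] \<open>0 < K\<close> by (simp add: gmp_M_def del: gmp_state.simps)
  qed
  then show ?thesis
    by (rule step)
qed

text \<open>Dividing by \<open>Ms i\<close> gives the divergences coefficient 1, so they telescope;
  the last one is nonnegative and is dropped.\<close>

lemma gmp_regret:
  assumes "x \<in> Q"
  shows "(\<Sum>i<k. 1 / Ms i * pairing (g (ws i)) (ws i - x)) \<le> V z0 x + \<epsilon> / 2 * (\<Sum>i<k. 1 / Ms i)"
proof -
  have "(\<Sum>i<k. 1 / Ms i * pairing (g (ws i)) (ws i - x))
      \<le> (\<Sum>i<k. (V (zs i) x - V (zs (Suc i)) x) + \<epsilon> / 2 * (1 / Ms i))"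
  proof (rule sum_mono)
    fix i
    have "accepted P g \<epsilon> (zs i) (Ms i)"
      unfolding gmp_M_eq by (intro line_search gmp_z_in_Q0 M_prev_pos)
    from accepted_step[OF gmp_z_in_Q0 gmp_M_pos this assms]
    have "pairing (g (ws i)) (ws i - x) \<le> Ms i * (V (zs i) x - V (zs (Suc i)) x) + \<epsilon> / 2"
      by (simp add: gmp_w_def gmp_z_Suc)
    then show "1 / Ms i * pairing (g (ws i)) (ws i - x)
        \<le> (V (zs i) x - V (zs (Suc i)) x) + \<epsilon> / 2 * (1 / Ms i)"
      using gmp_M_pos[of i] by (simp add: field_simps)
  qed
  also have "\<dots> = V (zs 0) x - V (zs k) x + \<epsilon> / 2 * (\<Sum>i<k. 1 / Ms i)"
    using sum_lessThan_telescope'[of "\<lambda>i. V (zs i) x" k] by (simp add: sum.distrib sum_distrib_left)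
  also have "\<dots> \<le> V z0 x + \<epsilon> / 2 * (\<Sum>i<k. 1 / Ms i)"
    using bregman_nonneg[OF gmp_z_in_Q0[of k] assms] by (simp add: gmp_z_def)
  finally show ?thesis .
qed

end

section \<open>The duality gap of the averaged iterates\<close>

locale saddle_mirror_prox =
  mirror_prox "Q1 \<times> Q2" Q0 d d' "saddle_operator gu gv" P \<epsilon> M_init z0
  for Q1 :: "'a::real_normed_vector set" and Q2 :: "'b::real_normed_vector set"
    and gu :: "'a \<Rightarrow> 'b \<Rightarrow> 'a dual" and gv :: "'a \<Rightarrow> 'b \<Rightarrow> 'b dual"
    and Q0 d d' P \<epsilon> M_init z0 +
  fixes f :: "'a \<Rightarrow> 'b \<Rightarrow> real"
  assumes convex_f: "\<And>v. v \<in> Q2 \<Longrightarrow> convex_on Q1 (\<lambda>u. f u v)"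
    and concave_f: "\<And>u. u \<in> Q1 \<Longrightarrow> concave_on Q2 (\<lambda>v. f u v)"
    and subgradient: "\<And>u v. u \<in> Q1 \<Longrightarrow> v \<in> Q2 \<Longrightarrow> is_subgradient (\<lambda>u'. f u' v) Q1 u (gu u v)"
    and supergradient:
      "\<And>u v. u \<in> Q1 \<Longrightarrow> v \<in> Q2 \<Longrightarrow> is_subgradient (\<lambda>v'. - f u v') Q2 v (- gv u v)"
begin

abbreviation "avg \<equiv> gmp_average P (saddle_operator gu gv) \<epsilon> M_init z0"

text \<open>Adding the subgradient and supergradient inequalities at \<open>w\<close> cancels the
  value of \<open>f\<close> at \<open>w\<close>.\<close>

lemma saddle_difference_le:
  assumes "w \<in> Q1 \<times> Q2" "u \<in> Q1" "v \<in> Q2"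
  shows "f (fst w) v - f u (snd w) \<le> pairing (saddle_operator gu gv w) (w - (u, v))"
proof -
  have w: "fst w \<in> Q1" "snd w \<in> Q2"
    using assms by auto
  have "f (fst w) (snd w) + gu (fst w) (snd w) (u - fst w) \<le> f u (snd w)"
    using subgradient[OF w] assms by (simp add: is_subgradient_def)
  moreover have "- f (fst w) (snd w) + (- gv (fst w) (snd w)) (v - snd w) \<le> - f (fst w) v"
    using supergradient[OF w] assms by (auto simp: is_subgradient_def)
  ultimately show ?thesis
    by (simp add: pairing_def saddle_operator_def blinfun.diff_right blinfun.minus_left)
qed

text \<open>Jensen's inequality in each variable reduces the average to the weighted sum in
  \<open>gmp_regret\<close>. The bound \<open>K\<close> is left free so that different bounds on
  \<open>Ms\<close> can be inserted.\<close>

lemma average_gap_le: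
  assumes "1 \<le> k" and K: "\<And>i. Ms i \<le> K" and u: "u \<in> Q1" and v: "v \<in> Q2"
  shows "f (fst (avg k)) v - f u (snd (avg k)) \<le> K / k * V z0 (u, v) + \<epsilon> / 2"
proof -
  define S where "S = (\<Sum>i<k. 1 / Ms i)"
  define c where "c i = 1 / Ms i / S" for i
  have "0 < K"
    using K[of 0] gmp_M_pos[of 0] by simp
  have "(\<Sum>i<k. 1 / K) \<le> S"
    unfolding S_def using K gmp_M_pos \<open>0 < K\<close> by (intro sum_mono divide_left_mono) auto
  then have S_ge: "k / K \<le> S"
    by simp
  then have "0 < S"
    using \<open>0 < K\<close> \<open>1 \<le> k\<close> by (smt (verit) divide_pos_pos of_nat_0_less_iff less_eq_Suc_le One_nat_def)
  have c: "0 \<le> c i" for i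
    using gmp_M_pos[of i] \<open>0 < S\<close> by (simp add: c_def)
  have c_sum: "(\<Sum>i<k. c i) = 1"
    using \<open>0 < S\<close> by (simp add: c_def flip: sum_divide_distrib S_def del: divide_divide_eq_left)
  have w: "fst (ws i) \<in> Q1" "snd (ws i) \<in> Q2" for i
    using gmp_w_in_Q[of i] by auto
  have avg: "fst (avg k) = (\<Sum>i<k. c i *\<^sub>R fst (ws i))" "snd (avg k) = (\<Sum>i<k. c i *\<^sub>R snd (ws i))"
    by (simp_all add: gmp_average_def c_def S_def fst_sum snd_sum scaleR_right.sum ac_simps)
  have "f (fst (avg k)) v \<le> (\<Sum>i<k. c i * f (fst (ws i)) v)"
    unfolding avg using \<open>1 \<le> k\<close> c c_sum w convex_f[OF v] by (intro convex_on_sum[of _ Q1]) auto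
  moreover have "- f u (snd (avg k)) \<le> (\<Sum>i<k. c i * - f u (snd (ws i)))"
    unfolding avg using \<open>1 \<le> k\<close> c c_sum w concave_f[OF u]
    by (intro convex_on_sum[of _ Q2]) (auto simp: concave_on_def)
  ultimately have "f (fst (avg k)) v - f u (snd (avg k))
      \<le> (\<Sum>i<k. c i * (f (fst (ws i)) v - f u (snd (ws i))))"
    by (simp add: right_diff_distrib sum_subtractf sum_negf)
  also have "\<dots> \<le> (\<Sum>i<k. c i * pairing (saddle_operator gu gv (ws i)) (ws i - (u, v)))"
    using c saddle_difference_le[OF gmp_w_in_Q u v] by (intro sum_mono mult_left_mono)
  also have "\<dots> = (\<Sum>i<k. 1 / Ms i * pairing (saddle_operator gu gv (ws i)) (ws i - (u, v))) / S"
    by (simp add: c_def sum_divide_distrib)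
  also have "\<dots> \<le> (V z0 (u, v) + \<epsilon> / 2 * S) / S"
    using gmp_regret[of "(u, v)" k] u v \<open>0 < S\<close> by (intro divide_right_mono) (auto simp: S_def)
  also have "\<dots> = V z0 (u, v) / S + \<epsilon> / 2"
    using \<open>0 < S\<close> by (simp add: field_simps)
  also have "V z0 (u, v) / S \<le> V z0 (u, v) / (k / K)"
    using S_ge \<open>0 < K\<close> \<open>1 \<le> k\<close> bregman_nonneg[OF z0, of "(u, v)"] u v
    by (intro divide_left_mono) (auto intro!: mult_pos_pos divide_pos_pos \<open>0 < S\<close>)
  finally show ?thesis
    by (simp add: mult.commute)
qed

end

section \<open>Finite suprema and the acceptance threshold\<close>

lemma duality_gap_le:
  assumes "Q1 \<noteq> {}" "Q2 \<noteq> {}"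
    and gap: "\<And>u v. u \<in> Q1 \<Longrightarrow> v \<in> Q2 \<Longrightarrow> f (fst x) v - f u (snd x) \<le> C"
  shows "duality_gap Q1 Q2 f x \<le> ereal C"
proof -
  define s where "s = (SUP v\<in>Q2. ereal (f (fst x) v))"
  have s_le: "s \<le> ereal (f u (snd x) + C)" if "u \<in> Q1" for u
    unfolding s_def using gap[OF that] by (intro SUP_least) (simp add: algebra_simps)
  obtain u0 v0 where "u0 \<in> Q1" "v0 \<in> Q2"
    using assms by auto
  then have "ereal (f (fst x) v0) \<le> s" "s \<le> ereal (f u0 (snd x) + C)"
    using s_le by (auto simp: s_def intro: SUP_upper)
  \<comment> \<open>Nonemptiness of both sets makes the supremum finite, which excludes a difference
    of infinities.\<close>
  then obtain r where r: "s = ereal r"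
    by (cases s) auto
  have "ereal (r - C) \<le> (INF u\<in>Q1. ereal (f u (snd x)))"
    using s_le by (intro INF_greatest) (auto simp: r algebra_simps)
  then have "ereal r - (INF u\<in>Q1. ereal (f u (snd x))) \<le> ereal r - ereal (r - C)"
    by (intro ereal_minus_mono) auto
  then show ?thesis
    by (simp add: duality_gap_def r flip: s_def)
qed

text \<open>This makes the supremum of \<open>V z0\<close> over the feasible set a real
  number.\<close>

lemma bregman_bounded_above:
  fixes Q :: "('a::real_normed_vector \<times> 'b::real_normed_vector) set"
  assumes "compact Q" "continuous_on Q d"
  shows "\<exists>C. \<forall>x\<in>Q. bregman d d' z x \<le> C"
proof -
  have "continuous_on Q (bregman d d' z)"
    unfolding bregman_def pairing_def by (intro continuous_intros assms)
  then have "bounded (bregman d d' z ` Q)"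
    using assms(1) compact_continuous_image compact_imp_bounded by blast
  then show ?thesis
    by (auto simp: bounded_iff abs_le_iff)
qed

text \<open>Young's inequality is applied with \<open>t = max_norm (w - z)\<close> and
  \<open>s = max_norm (w - z')\<close>, so its right side is exactly that of the acceptance
  test.\<close>

lemma accepted_if_smooth_const_le:
  assumes hc: "holder_constants Q1 Q2 gu gv \<nu> a b c e" and \<nu>: "\<nu> \<in> {0..1}" and "0 < \<epsilon>"
    and P: "prox_mapping (Q1 \<times> Q2) Q0 d' P" and "Q0 \<subseteq> Q1 \<times> Q2"
    and z: "z \<in> Q0" and M: "0 < M" "smooth_const \<epsilon> \<nu> (a + b + c + e) \<le> M"
  shows "accepted P (saddle_operator gu gv) \<epsilon> z M"
proof -
  define w where "w = trial_w P (saddle_operator gu gv) z M"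
  define z' where "z' = trial_z P (saddle_operator gu gv) z M"
  have "w \<in> Q0"
    using P z M unfolding w_def trial_w_def prox_mapping_def by blast
  then have "z \<in> Q1 \<times> Q2" "w \<in> Q1 \<times> Q2"
    using \<open>Q0 \<subseteq> Q1 \<times> Q2\<close> z by auto
  then have "pairing (saddle_operator gu gv w - saddle_operator gu gv z) (w - z')
      \<le> (a + b + c + e) * hpow (max_norm (w - z)) \<nu> * max_norm (w - z')"
    using saddle_operator_hoelder[OF hc] \<nu> by simp
  also have "\<dots> \<le> M / 2 * ((max_norm (w - z))\<^sup>2 + (max_norm (w - z'))\<^sup>2) + \<epsilon> / 2"
    using hc \<nu> M \<open>0 < \<epsilon>\<close> by (intro hoelder_le_quadratic) (simp_all add: holder_constants_def)
  finally show ?thesis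
    by (simp add: accepted_def w_def z'_def)
qed

lemma holder_family_finite_iff:
  assumes "holder_family Q1 Q2 gu gv L" "\<mu> \<in> {0..1}"
  shows "L \<mu> \<noteq> \<infinity> \<longleftrightarrow> (\<exists>a b c e. holder_constants Q1 Q2 gu gv \<mu> a b c e)"
    and "L \<mu> \<noteq> \<infinity> \<Longrightarrow>
      \<exists>a b c e. holder_constants Q1 Q2 gu gv \<mu> a b c e \<and> L \<mu> = ereal (a + b + c + e)"
  using assms unfolding holder_family_def by (smt (verit) PInfty_neq_ereal(1))+

lemma ereal_powr_divide:
  assumes "0 < \<epsilon>" "0 \<le> l" "0 \<le> \<mu>"
  shows "ereal_powr (ereal l / ereal \<epsilon>) (2 / (1 + \<mu>)) = ereal (smooth_const \<epsilon> \<mu> l / \<epsilon>)"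
  using assms by (simp add: ereal_powr_def smooth_const_eq)

text \<open>The conditions on \<open>M_init\<close> keep the first trial \<open>M_init / 2\<close>
  within twice the threshold; the search lowers \<open>M\<close> by at most a factor 2 per
  iteration. The \<open>max 1\<close> accounts for needing at least one iteration.\<close>

theorem theorem3:
  fixes f :: "'a::real_normed_vector \<Rightarrow> 'b::real_normed_vector \<Rightarrow> real"
    and Q1 :: "'a set" and Q2 :: "'b set"
    and gu :: "'a \<Rightarrow> 'b \<Rightarrow> 'a dual" and gv :: "'a \<Rightarrow> 'b \<Rightarrow> 'b dual"
    and Q0 :: "('a \<times> 'b) set" and d :: "'a \<times> 'b \<Rightarrow> real"
    and d' :: "'a \<times> 'b \<Rightarrow> 'a dual \<times> 'b dual"
    and P :: "'a dual \<times> 'b dual \<Rightarrow> 'a \<times> 'b \<Rightarrow> real \<Rightarrow> 'a \<times> 'b"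
    and z0 :: "'a \<times> 'b"
    and \<epsilon> M_init \<nu> L11 L12 L21 L22 L\<nu> :: real
  assumes "finite_dimensional TYPE('a)" and "finite_dimensional TYPE('b)"
    and "convex Q1" and "closed Q1" and "convex Q2" and "closed Q2"
    and "bounded (Q1 \<times> Q2)"
    and "\<forall>v\<in>Q2. convex_on Q1 (\<lambda>u. f u v)"
    and "\<forall>u\<in>Q1. concave_on Q2 (\<lambda>v. f u v)"
    and "\<forall>u\<in>Q1. \<forall>v\<in>Q2. is_subgradient (\<lambda>u'. f u' v) Q1 u (gu u v)"
    and "\<forall>u\<in>Q1. \<forall>v\<in>Q2. is_subgradient (\<lambda>v'. - f u v') Q2 v (- gv u v)"
    and "\<nu> \<in> {0..1}"
    and "holder_constants Q1 Q2 gu gv \<nu> L11 L12 L21 L22"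
    and "L\<nu> = L11 + L12 + L21 + L22"
    and "prox_setup (Q1 \<times> Q2) Q0 d d'"
    and "prox_mapping (Q1 \<times> Q2) Q0 d' P"
    and "z0 \<in> Q0" and "is_arg_min d (\<lambda>x. x \<in> Q1 \<times> Q2) z0"
    and "\<epsilon> > 0" and "M_init > 0"
  shows
    "(M_init \<le> 4 * (\<epsilon> powr (- ((1 - \<nu>) / (1 + \<nu>))) * L\<nu> powr (2 / (1 + \<nu>))) \<longrightarrow>
      (\<forall>k\<ge>1.
        duality_gap Q1 Q2 f (gmp_average P (saddle_operator gu gv) \<epsilon> M_init z0 k)
        \<le> ereal (2 * L\<nu> powr (2 / (1 + \<nu>)) / (real k * \<epsilon> powr ((1 - \<nu>) / (1 + \<nu>))))
            * (SUP x\<in>Q1 \<times> Q2. ereal (bregman d d' z0 x)) + ereal (\<epsilon> / 2)))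
     \<and>
     (\<forall>L :: real \<Rightarrow> ereal.
        holder_family Q1 Q2 gu gv L \<longrightarrow>
        (\<forall>\<mu>\<in>{0..1}. ereal M_init \<le>
            4 * (ereal (\<epsilon> powr (- ((1 - \<mu>) / (1 + \<mu>)))) * ereal_powr (L \<mu>) (2 / (1 + \<mu>)))) \<longrightarrow>
        (\<exists>k\<ge>1.
           ereal (real k) \<le> max 1 (8 * ((INF \<mu>\<in>{0..1}. ereal_powr (L \<mu> / ereal \<epsilon>) (2 / (1 + \<mu>)))
                                       * (SUP x\<in>Q1 \<times> Q2. ereal (bregman d d' z0 x)))) \<and>
           duality_gap Q1 Q2 f (gmp_average P (saddle_operator gu gv) \<epsilon> M_init z0 k) \<le> ereal \<epsilon>))"
proof -
  define sm where "sm = smooth_const \<epsilon> \<nu> L\<nu>"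
  have Q0: "Q0 \<subseteq> Q1 \<times> Q2" and d: "continuous_on (Q1 \<times> Q2) d"
    using assms(15) by (auto simp: prox_setup_def)
  have accepted: "accepted P (saddle_operator gu gv) \<epsilon> z M"
    if "holder_constants Q1 Q2 gu gv \<mu> a b c e" "\<mu> \<in> {0..1}"
      "z \<in> Q0" "0 < M" "smooth_const \<epsilon> \<mu> (a + b + c + e) \<le> M" for \<mu> a b c e z M
    using accepted_if_smooth_const_le[OF that(1,2) assms(19,16) Q0 that(3-5)] .
  \<comment> \<open>The exponent \<nu> supplies the threshold for termination; the iterates do not
    depend on it and serve both claims.\<close>
  interpret saddle_mirror_prox Q1 Q2 gu gv Q0 d d' P \<epsilon> M_init z0 f
  proof
    show "\<exists>K. \<forall>z\<in>Q0. \<forall>M>0. K \<le> M \<longrightarrow> accepted P (saddle_operator gu gv) \<epsilon> z M"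
      using accepted[OF assms(13,12)] by blast
  qed (use assms in blast)+

  have Q: "Q1 \<noteq> {}" "Q2 \<noteq> {}"
    using z0 Q0 by auto
  define D where "D = (SUP x\<in>Q1 \<times> Q2. ereal (V z0 x))"
  have "compact (Q1 \<times> Q2)"
    using assms(1-6) bounded_fst[OF assms(7)] bounded_snd[OF assms(7)] Q
    by (intro compact_Times finite_dimensional_compact) simp_all
  from bregman_bounded_above[OF this d]
  obtain C where "\<And>x. x \<in> Q1 \<times> Q2 \<Longrightarrow> V z0 x \<le> C"
    by blast
  then have "D \<le> ereal C"
    unfolding D_def by (intro SUP_least) simp
  moreover have V_le: "ereal (V z0 x) \<le> D" if "x \<in> Q1 \<times> Q2" for x
    unfolding D_def using that by (rule SUP_upper)
  moreover have "V z0 z0 = 0"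
    by (simp add: bregman_def pairing_def)
  \<comment> \<open>Compactness bounds \<open>D\<close> above, and the value 0 at \<open>z0\<close>
    bounds it below.\<close>
  ultimately obtain D' where D': "D = ereal D'"
    using V_le[OF Q0_subset[OF z0]] by (cases D) auto
  have gap: "duality_gap Q1 Q2 f (avg k) \<le> ereal (K / k * D' + \<epsilon> / 2)"
    if "1 \<le> k" "\<And>i. Ms i \<le> K" for k K
  proof (rule duality_gap_le[OF Q])
    fix u v assume uv: "u \<in> Q1" "v \<in> Q2"
    have "0 < K"
      using gmp_M_pos[of 0] that(2)[of 0] by simp
    moreover have "V z0 (u, v) \<le> D'"
      using V_le[of "(u, v)"] uv D' by simp
    ultimately have "K / k * V z0 (u, v) \<le> K / k * D'"
      by (intro mult_left_mono) auto
    then show "f (fst (avg k)) v - f u (snd (avg k)) \<le> K / k * D' + \<epsilon> / 2"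
      using average_gap_le[OF that uv] by simp
  qed

  \<comment> \<open>The rate for the given exponent\<close>
  have "duality_gap Q1 Q2 f (avg k)
      \<le> ereal (2 * L\<nu> powr (2 / (1 + \<nu>)) / (real k * \<epsilon> powr ((1 - \<nu>) / (1 + \<nu>)))) * D + ereal (\<epsilon> / 2)"
    if "M_init \<le> 4 * sm" "1 \<le> k" for k
  proof -
    have "Ms i \<le> 2 * sm" for i
      using accepted[OF assms(13,12)] that(1) by (intro gmp_M_le) (simp_all add: sm_def assms(14))
    from gap[OF that(2) this] show ?thesis
      by (simp add: D' sm_def smooth_const_def powr_minus field_simps)
  qed

  \<comment> \<open>The iteration count, uniformly over all exponents\<close>
  moreover have "\<exists>k\<ge>1. ereal (real k)
        \<le> max 1 (8 * ((INF \<mu>\<in>{0..1}. ereal_powr (L \<mu> / ereal \<epsilon>) (2 / (1 + \<mu>))) * D))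
      \<and> duality_gap Q1 Q2 f (avg k) \<le> ereal \<epsilon>"
    if L: "holder_family Q1 Q2 gu gv L"
      and M_init_le: "\<And>\<mu>. \<mu> \<in> {0..1} \<Longrightarrow> ereal M_init \<le>
        4 * (ereal (\<epsilon> powr (- ((1 - \<mu>) / (1 + \<mu>)))) * ereal_powr (L \<mu>) (2 / (1 + \<mu>)))" for L
  proof -
    define A where "A = (INF \<mu>\<in>{0..1}. ereal_powr (L \<mu> / ereal \<epsilon>) (2 / (1 + \<mu>)))"
    have finite_exponent: "\<exists>l\<ge>0. ereal_powr (L \<mu> / ereal \<epsilon>) (2 / (1 + \<mu>)) = ereal (l / \<epsilon>)
        \<and> (\<forall>i. Ms i \<le> 2 * l)" if \<mu>: "\<mu> \<in> {0..1}" "L \<mu> \<noteq> \<infinity>" for \<mu>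
    proof -
      obtain a b c e where hc: "holder_constants Q1 Q2 gu gv \<mu> a b c e"
        and L\<mu>: "L \<mu> = ereal (a + b + c + e)"
        using holder_family_finite_iff(2)[OF L \<mu>] by blast
      have "0 \<le> a + b + c + e"
        using hc by (simp add: holder_constants_def)
      have "M_init \<le> 4 * smooth_const \<epsilon> \<mu> (a + b + c + e)"
        using M_init_le[OF \<mu>(1)] by (simp add: L\<mu> ereal_powr_def smooth_const_def)
      then have "Ms i \<le> 2 * smooth_const \<epsilon> \<mu> (a + b + c + e)" for i
        using accepted[OF hc \<mu>(1)] by (intro gmp_M_le)
      then show ?thesis
        using ereal_powr_divide[OF \<open>\<epsilon> > 0\<close> \<open>0 \<le> a + b + c + e\<close>, of \<mu>] \<mu>(1)
        by (intro exI[of _ "smooth_const \<epsilon> \<mu> (a + b + c + e)"]) (simp add: L\<mu> smooth_const_def)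
    qed
    \<comment> \<open>The same \<open>Ms i\<close> obeys the bound for every exponent, so the
      infimum may be taken without a minimising exponent.\<close>
    have M_le_A: "ereal (Ms i / (2 * \<epsilon>)) \<le> A" for i
      unfolding A_def
    proof (rule INF_greatest)
      fix \<mu> :: real assume \<mu>: "\<mu> \<in> {0..1}"
      show "ereal (Ms i / (2 * \<epsilon>)) \<le> ereal_powr (L \<mu> / ereal \<epsilon>) (2 / (1 + \<mu>))"
      proof (cases "L \<mu> = \<infinity>")
        case True
        then show ?thesis
          using \<open>\<epsilon> > 0\<close> by (simp add: ereal_powr_def)
      next
        case False
        from finite_exponent[OF \<mu> False] show ?thesis
          using \<open>\<epsilon> > 0\<close> by (auto simp: field_simps)
      qed
    qed
    have "L \<nu> \<noteq> \<infinity>"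
      using holder_family_finite_iff(1)[OF L assms(12)] assms(13) by blast
    from finite_exponent[OF assms(12) this] obtain l where
      "ereal_powr (L \<nu> / ereal \<epsilon>) (2 / (1 + \<nu>)) = ereal l"
      by blast
    then have "A \<le> ereal l"
      unfolding A_def using INF_lower[OF assms(12), of "\<lambda>\<mu>. ereal_powr (L \<mu> / ereal \<epsilon>) (2 / (1 + \<mu>))"]
      by simp
    \<comment> \<open>The exponent \<nu> bounds \<open>A\<close> above, and the real lower bound
      from \<open>Ms 0\<close> excludes minus infinity.\<close>
    then obtain A' where A': "A = ereal A'"
      using M_le_A[of 0] by (cases A) auto
    have M_le: "Ms i \<le> 2 * \<epsilon> * A'" for i
      using M_le_A[of i] \<open>\<epsilon> > 0\<close> by (simp add: A' field_simps)
    \<comment> \<open>With \<open>K = 2 * \<epsilon> * A'\<close> the gap is at most \<epsilon> once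
      \<open>k\<close> reaches \<open>4 * (A' * D')\<close>. Rounding a number above 1 up at most
      doubles it, hence the factor 8; otherwise \<open>k = 1\<close> suffices.\<close>
    obtain k :: nat where k: "1 \<le> k" "4 * (A' * D') \<le> k" "k \<le> max 1 (8 * (A' * D'))"
    proof (cases "4 * (A' * D') \<le> 1")
      case True
      then show ?thesis
        by (intro that[of 1]) auto
    next
      case False
      then have "real (nat \<lceil>4 * (A' * D')\<rceil>) = of_int \<lceil>4 * (A' * D')\<rceil>"
        by simp
      with False show ?thesis
        by (intro that[of "nat \<lceil>4 * (A' * D')\<rceil>"]) linarith+
    qed
    have "2 * \<epsilon> * A' / k * D' = \<epsilon> / 2 * (4 * (A' * D') / k)"
      by simp
    also have "\<dots> \<le> \<epsilon> / 2 * 1"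
      using k \<open>\<epsilon> > 0\<close> by (intro mult_left_mono) simp_all
    finally have "duality_gap Q1 Q2 f (avg k) \<le> ereal \<epsilon>"
      using gap[OF k(1) M_le] by (elim order_trans) simp
    then show ?thesis
      using k(1,3) by (intro exI[of _ k]) (simp add: D' A' le_max_iff_disj one_ereal_def flip: A_def)
  qed
  ultimately show ?thesis
    unfolding D_def sm_def smooth_const_def by blast
qed

end
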